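(* Let $n\ge 9$ and let $F$ be either $tP_\ell$ for some integers $t\ge 1$, $\ell\ge 2$ with $5\le t\ell\le n-1$, or $C_\ell$ for some $\ell\ge 4$. If $G$ has the maximum $Q$-index among all connected outerplanar graphs of order $n$ that do not contain $F$ as a subgraph, then $G$ contains $K_{1,n-1}$ as a subgraph (i.e., $G$ has a vertex of degree $n-1$).
   Context: For a graph $G$, $Q(G)=D(G)+A(G)$ is the signless Laplacian matrix and the $Q$-index $q(G)$ is its largest eigenvalue. $P_\ell$ is the path on $\ell$ vertices, $tP_\ell$ the disjoint union of $t$ copies, $C_\ell$ the cycle on $\ell$ vertices. A graph is outerplanar if it has a planar embedding with all vertices on the boundary of the outer face. *)

theory Defs
  imports "HOL-Analysis.Analysis"
begin

text \<open>Finite simple graphs: vertex set V, edge set E of 2-element subsets of V.\<close>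
definition simple_graph :: "'a set \<Rightarrow> 'a set set \<Rightarrow> bool" where
  "simple_graph V E \<longleftrightarrow> finite V \<and> (\<forall>e\<in>E. \<exists>u v. u \<in> V \<and> v \<in> V \<and> u \<noteq> v \<and> e = {u, v})"

definition connected_graph :: "'a set \<Rightarrow> 'a set set \<Rightarrow> bool" where
  "connected_graph V E \<longleftrightarrow> V \<noteq> {} \<and>
     (\<forall>u\<in>V. \<forall>v\<in>V. (u, v) \<in> {(x, y). {x, y} \<in> E}\<^sup>*)"

definition degree :: "'a set \<Rightarrow> 'a set set \<Rightarrow> 'a \<Rightarrow> nat" where
  "degree V E v = card {u \<in> V. {u, v} \<in> E}"

text \<open>Eigenvalues of the signless Laplacian Q = D + A (real symmetric, so real eigenvalues
  with real eigenvectors x : V \<rightarrow> real).\<close>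
definition Q_eigenvalue :: "'a set \<Rightarrow> 'a set set \<Rightarrow> real \<Rightarrow> bool" where
  "Q_eigenvalue V E \<mu> \<longleftrightarrow> (\<exists>x :: 'a \<Rightarrow> real. (\<exists>v\<in>V. x v \<noteq> 0) \<and>
     (\<forall>v\<in>V. real (degree V E v) * x v + (\<Sum>u\<in>{u \<in> V. {u, v} \<in> E}. x u) = \<mu> * x v))"

text \<open>The Q-index: the largest eigenvalue of Q(G).\<close>
definition Q_index :: "'a set \<Rightarrow> 'a set set \<Rightarrow> real" where
  "Q_index V E = Max {\<mu>. Q_eigenvalue V E \<mu>}"

text \<open>Outerplanarity: a planar drawing in the plane (identified with \<complex>): vertices are
  distinct points, edges are arcs between their end points meeting no other vertex,
  distinct edges meet only in common end points; all vertices lie on the boundary of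
  the outer (unbounded) face, i.e. in the closure of the unbounded component of the
  complement of the drawing.\<close>
definition outerplanar :: "'a set \<Rightarrow> 'a set set \<Rightarrow> bool" where
  "outerplanar V E \<longleftrightarrow> (\<exists>(p :: 'a \<Rightarrow> complex) (\<gamma> :: 'a set \<Rightarrow> real \<Rightarrow> complex).
     inj_on p V \<and>
     (\<forall>e\<in>E. arc (\<gamma> e) \<and> {pathstart (\<gamma> e), pathfinish (\<gamma> e)} = p ` e \<and>
              path_image (\<gamma> e) \<inter> p ` V = p ` e) \<and>
     (\<forall>e\<in>E. \<forall>e'\<in>E. e \<noteq> e' \<longrightarrow> path_image (\<gamma> e) \<inter> path_image (\<gamma> e') \<subseteq> p ` (e \<inter> e')) \<and>
     (\<forall>v\<in>V. p v \<in> closure (outside (p ` V \<union> (\<Union>e\<in>E. path_image (\<gamma> e))))))"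

text \<open>F is a subgraph of G (up to isomorphism): injective edge-preserving vertex map.\<close>
definition contains_subgraph :: "'b set \<Rightarrow> 'b set set \<Rightarrow> 'a set \<Rightarrow> 'a set set \<Rightarrow> bool" where
  "contains_subgraph VF EF V E \<longleftrightarrow>
     (\<exists>f. inj_on f VF \<and> f ` VF \<subseteq> V \<and> (\<forall>e\<in>EF. f ` e \<in> E))"

text \<open>tP_l: vertices 0..tl-1, blocks of l consecutive vertices form paths.\<close>
definition path_forest :: "nat \<Rightarrow> nat \<Rightarrow> nat set \<times> nat set set" where
  "path_forest t l = ({0..<t * l}, {{i, Suc i} | i. Suc i < t * l \<and> Suc i mod l \<noteq> 0})"

definition cycle_graph :: "nat \<Rightarrow> nat set \<times> nat set set" where
  "cycle_graph l = ({0..<l}, {{i, (Suc i) mod l} | i. i < l})"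

definition admissible :: "nat \<Rightarrow> nat set \<Rightarrow> nat set set \<Rightarrow> 'a set \<Rightarrow> 'a set set \<Rightarrow> bool" where
  "admissible n VF EF V E \<longleftrightarrow> simple_graph V E \<and> card V = n \<and> connected_graph V E \<and>
     outerplanar V E \<and> \<not> contains_subgraph VF EF V E"

end

theory Submission
  imports Defs "Jordan_Normal_Form.Spectral_Radius"
begin

text \<open>The star of order $n$ is a competitor: it has the eigenvalue $n$, and $F$ is not contained in it,
  because $F$ has two disjoint edges. So it suffices that $q(G) < n$ whenever $G$ has no vertex of
  degree $n - 1$. The only consequence of outerplanarity needed for this is the absence of $K_{2,3}$:
  two vertices have at most two common neighbours.

  Suppose $\mu \ge n$ is an eigenvalue, and scale an eigenvector so that its largest absolute value
  is $1$, attained at $c$. The eigenvalue equation at $c$ makes the sum over $N(c)$ at least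
  $k = n - d(c)$. Adding the equations over $N(c)$, in which every vertex other than $c$ has at most two
  neighbours, bounds that sum from above. The two bounds are incompatible if $k \ge 3$. For $k = 2$ a few rounds of
  inserting bounds for the entries back into the eigenvalue equations are needed.\<close>

section \<open>Outerplanar graphs contain no $K_{2,3}$\<close>

lemma frontier_point_meets_open:
  assumes "x \<in> frontier S" "open U" "x \<in> U"
  shows "S \<inter> U \<noteq> {}"
  using assms by (metis Diff_iff closure_iff_nhds_not_empty frontier_def inf_commute subset_refl)

text \<open>Running along \<open>g\<close> and back along \<open>h\<close> gives a simple closed
  curve with image \<open>J\<close>, so this is the Jordan curve theorem for that curve.\<close>

lemma Jordan_two_arcs:
  fixes g h :: "real \<Rightarrow> complex"
  assumes "arc g" "arc h" "pathstart g = a" "pathfinish g = b" "pathstart h = a" "pathfinish h = b"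
    and "path_image g \<inter> path_image h = {a, b}"
  defines "J \<equiv> path_image g \<union> path_image h"
  shows "inside J \<noteq> {}" "open (inside J)" "connected (inside J)"
    "open (outside J)" "connected (outside J)" "inside J \<inter> outside J = {}"
    "inside J \<union> outside J = - J" "frontier (inside J) = J" "compact J"
proof -
  let ?c = "g +++ reversepath h"
  have "simple_path ?c"
    using assms by (intro simple_path_join_loop) (auto simp: arc_reversepath)
  moreover have "pathfinish ?c = pathstart ?c"
    using assms by simp
  moreover have J: "path_image ?c = J"
    using assms by (simp add: path_image_join)
  ultimately show "inside J \<noteq> {}" "open (inside J)" "connected (inside J)"
    "open (outside J)" "connected (outside J)" "inside J \<inter> outside J = {}"
    "inside J \<union> outside J = - J" "frontier (inside J) = J" "compact J"
    using Jordan_inside_outside[of ?c] compact_simple_path_image[of ?c] by (simp_all add: J)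
qed

text \<open>The inside and the outside are disjoint open sets covering the complement of
  \<open>J\<close>, so a single point decides on which side a connected set off \<open>J\<close>
  lies.\<close>

lemma connected_in_outside:
  assumes "open (inside J)" "open (outside J)" "inside J \<inter> outside J = {}"
    "inside J \<union> outside J = - J" "connected C" "C \<inter> J = {}" "C \<inter> outside J \<noteq> {}"
  shows "C \<subseteq> outside J"
proof -
  have "C \<subseteq> inside J \<union> outside J"
    using assms by auto
  then have "inside J \<inter> C = {} \<or> outside J \<inter> C = {}"
    using connectedD[OF \<open>connected C\<close>, of "inside J" "outside J"] assms by blast
  with \<open>C \<subseteq> _\<close> assms show ?thesis by blast
qed

text \<open>If every arc met only the outside of the other two, the region between the first two arcs
  would be joined to infinity off each of the other two cycles. These meet in the connected third
  arc, so by Janiszewski's theorem it would be joined to infinity off all three arcs.\<close>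
lemma theta_curve_interior_points:
  fixes g1 g2 g3 :: "real \<Rightarrow> complex"
  assumes arcs: "arc g1" "arc g2" "arc g3"
    and ends: "pathstart g1 = a" "pathfinish g1 = b" "pathstart g2 = a" "pathfinish g2 = b"
      "pathstart g3 = a" "pathfinish g3 = b"
    and meet: "path_image g1 \<inter> path_image g2 = {a, b}" "path_image g1 \<inter> path_image g3 = {a, b}"
      "path_image g2 \<inter> path_image g3 = {a, b}"
    and m: "m1 \<in> path_image g1 - {a, b}" "m2 \<in> path_image g2 - {a, b}"
      "m3 \<in> path_image g3 - {a, b}"
    and sub: "path_image g1 \<union> path_image g2 \<union> path_image g3 \<subseteq> D"
  shows "\<not> {m1, m2, m3} \<subseteq> closure (outside D)"
proof
  assume cl: "{m1, m2, m3} \<subseteq> closure (outside D)"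
  define J12 where "J12 = path_image g1 \<union> path_image g2"
  define J13 where "J13 = path_image g1 \<union> path_image g3"
  define J23 where "J23 = path_image g2 \<union> path_image g3"
  note J = J12_def J13_def J23_def
  note K12 = Jordan_two_arcs[OF arcs(1,2) ends(1-4) meet(1), folded J12_def]
  note K13 = Jordan_two_arcs[OF arcs(1,3) ends(1,2,5,6) meet(2), folded J13_def]
  note K23 = Jordan_two_arcs[OF arcs(2,3) ends(3-6) meet(3), folded J23_def]
  \<comment> \<open>The inside of \<open>C\<close> is disjoint from \<open>outside C\<close>, hence
    from the smaller \<open>outside D\<close>; being open, it also misses the closure of
    \<open>outside D\<close>.\<close>
  have out: "x \<in> outside C"
    if "x \<in> closure (outside D)" "C \<subseteq> D" "open (inside C)" "inside C \<inter> outside C = {}"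
      "inside C \<union> outside C = - C" "x \<notin> C" for x C
  proof -
    have "inside C \<inter> closure (outside D) = {}"
      using outside_mono[OF that(2)] that(3,4)
      by (metis (no_types, lifting) disjoint_iff open_Int_closure_eq_empty subset_iff)
    then show ?thesis using that by blast
  qed
  have m1: "m1 \<in> outside J23" and m2: "m2 \<in> outside J13" and m3: "m3 \<in> outside J12"
    using cl sub m meet K12 K13 K23 by (intro out; auto simp: J)+
  have g3: "path_image g3 - {a, b} \<subseteq> outside J12"
  proof (rule connected_in_outside)
    show "connected (path_image g3 - {a, b})"
      using connected_simple_path_endless[OF arc_imp_simple_path[OF arcs(3)]] ends by simp
    show "(path_image g3 - {a, b}) \<inter> outside J12 \<noteq> {}" using m m3 by blast
    show "(path_image g3 - {a, b}) \<inter> J12 = {}" using meet by (auto simp: J)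
  qed (use K12 in auto)
  then have disj: "inside J12 \<inter> (J13 \<union> J23) = {}"
    using K12(6,7) meet unfolding J by blast
  \<comment> \<open>By \<open>disj\<close> the region inside \<open>J12\<close> avoids all three
    arcs, so one common point suffices. It exists because \<open>m2\<close> lies on the frontier of
    \<open>inside J12\<close> and in the open set \<open>outside J13\<close>; below,
    \<open>m1\<close> does the same for \<open>J23\<close>.\<close>
  have "inside J12 \<subseteq> outside J13"
  proof (rule connected_in_outside)
    show "inside J12 \<inter> outside J13 \<noteq> {}"
      by (rule frontier_point_meets_open[OF _ K13(4) m2]) (use K12 m in \<open>auto simp: J12_def\<close>)
  qed (use K12 K13 disj in auto)
  have "inside J12 \<subseteq> outside J23"
  proof (rule connected_in_outside)
    show "inside J12 \<inter> outside J23 \<noteq> {}"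
      by (rule frontier_point_meets_open[OF _ K23(4) m1]) (use K12 m in \<open>auto simp: J12_def\<close>)
  qed (use K12 K23 disj in auto)
  obtain x where x: "x \<in> inside J12" using K12(1) by blast
  have "bounded (J12 \<union> J13)" using K12(9) K13(9) by (simp add: compact_imp_bounded)
  \<comment> \<open>\<open>J12 \<union> J13\<close> already consists of all three arcs, so
    \<open>y\<close> is outside each of the three cycles.\<close>
  then obtain y where y: "y \<in> outside (J12 \<union> J13)" using outside_bounded_nonempty by blast
  then have y': "y \<in> outside J12" "y \<in> outside J13" "y \<in> outside J23"
    using outside_mono[of J12 "J12 \<union> J13"] outside_mono[of J13 "J12 \<union> J13"]
      outside_mono[of J23 "J12 \<union> J13"] by (auto simp: J)
  have "connected_component (- (J13 \<union> J23)) x y"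
  proof (rule Janiszewski)
    have "J13 \<inter> J23 = path_image g3" using meet arcs ends unfolding J by (auto simp: set_eq_iff)
    then show "connected (J13 \<inter> J23)" using arcs(3) by (simp add: connected_arc_image)
    show "connected_component (- J13) x y"
      using x y' \<open>inside J12 \<subseteq> outside J13\<close> K13(5) outside_no_overlap[of J13]
      by (intro connected_componentI[of "outside J13"]) blast+
    show "connected_component (- J23) x y"
      using x y' \<open>inside J12 \<subseteq> outside J23\<close> K23(5) outside_no_overlap[of J23]
      by (intro connected_componentI[of "outside J23"]) blast+
  qed (use K13 K23 in \<open>auto intro: compact_imp_closed\<close>)
  then have "connected_component (- J12) x y"
    by (rule connected_component_of_subset) (auto simp: J)
  then show False
    using inside_same_component x y'(1) K12(6) by blast
qed

text \<open>Three common neighbours of \<open>a\<close> and \<open>b\<close> would yield three paths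
  of length two that are drawn as a theta curve. The middle vertices lie in the interiors of its
  three arcs, so they cannot all be on the outer face.\<close>

lemma outerplanar_codegree_le_2:
  assumes G: "simple_graph V E" "outerplanar V E" and "a \<noteq> b"
  shows "card {u \<in> V. {u, a} \<in> E \<and> {u, b} \<in> E} \<le> 2"
proof (rule ccontr)
  assume "\<not> ?thesis"
  then have "3 \<le> card {u \<in> V. {u, a} \<in> E \<and> {u, b} \<in> E}" by simp
  then obtain T where T: "T \<subseteq> {u \<in> V. {u, a} \<in> E \<and> {u, b} \<in> E}" "card T = 3"
    by (meson obtain_subset_with_card_n)
  from T(2)[unfolded card_3_iff] obtain c1 c2 c3 where Teq: "T = {c1, c2, c3}" and dist: "c1 \<noteq> c2" "c1 \<noteq> c3" "c2 \<noteq> c3"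
    by (elim exE conjE) rule
  have cE: "{a, c} \<in> E" "{c, b} \<in> E" if "c \<in> T" for c
    using that T(1) insert_commute[of a c] by auto
  have edge: "u \<noteq> v" "u \<in> V" "v \<in> V" if "{u, v} \<in> E" for u v
    using G(1) that unfolding simple_graph_def by (metis doubleton_eq_iff)+
  obtain p :: "'a \<Rightarrow> complex" and \<gamma> where
    inj: "inj_on p V" and
    arcs: "\<forall>e\<in>E. arc (\<gamma> e) \<and> {pathstart (\<gamma> e), pathfinish (\<gamma> e)} = p ` e \<and>
      path_image (\<gamma> e) \<inter> p ` V = p ` e" and
    meets: "\<forall>e\<in>E. \<forall>e'\<in>E. e \<noteq> e' \<longrightarrow> path_image (\<gamma> e) \<inter> path_image (\<gamma> e') \<subseteq> p ` (e \<inter> e')" and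
    outer: "\<forall>v\<in>V. p v \<in> closure (outside (p ` V \<union> (\<Union>e\<in>E. path_image (\<gamma> e))))"
    using G(2) unfolding outerplanar_def by blast
  have arc: "arc (\<gamma> e)" and ends: "{pathstart (\<gamma> e), pathfinish (\<gamma> e)} = p ` e" if "e \<in> E" for e
    using arcs that by auto
  have meet: "path_image (\<gamma> e) \<inter> path_image (\<gamma> e') \<subseteq> p ` (e \<inter> e')"
    if "e \<in> E" "e' \<in> E" "e \<noteq> e'" for e e'
    using meets that by blast
  let ?im = "\<lambda>e. path_image (\<gamma> e)"
  \<comment> \<open>A drawing fixes only the set of end points of an edge, so the arc may have to be
    reversed to run from \<open>u\<close> to \<open>v\<close>.\<close>
  have oriented: "\<exists>h. arc h \<and> pathstart h = p u \<and> pathfinish h = p v \<and> path_image h = ?im {u, v}"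
    if "{u, v} \<in> E" for u v
  proof -
    from ends[OF that] consider "pathstart (\<gamma> {u, v}) = p u" "pathfinish (\<gamma> {u, v}) = p v"
      | "pathstart (\<gamma> {u, v}) = p v" "pathfinish (\<gamma> {u, v}) = p u"
      by (auto simp: doubleton_eq_iff)
    then show ?thesis
    proof cases
      case 1
      then show ?thesis using arc[OF that] by blast
    next
      case 2
      then show ?thesis using arc[OF that]
        by (intro exI[of _ "reversepath (\<gamma> {u, v})"]) (simp add: arc_reversepath)
    qed
  qed
  have mem: "c1 \<in> T" "c2 \<in> T" "c3 \<in> T" using Teq by simp_all
  have ab: "a \<in> V" "b \<in> V" using edge(2)[OF cE(1)[OF mem(1)]] edge(3)[OF cE(2)[OF mem(1)]] .
  have cV: "c \<in> V" "c \<noteq> a" "c \<noteq> b" if "c \<in> T" for c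
    using edge(1)[OF cE(1)[OF that]] edge(1,2)[OF cE(2)[OF that]] by simp_all
  have joined: "\<exists>h. arc h \<and> pathstart h = p a \<and> pathfinish h = p b
    \<and> path_image h = ?im {a, c} \<union> ?im {c, b}" if c: "c \<in> T" for c
  proof -
    obtain h1 where h1: "arc h1" "pathstart h1 = p a" "pathfinish h1 = p c" "path_image h1 = ?im {a, c}"
      using oriented[OF cE(1)[OF c]] by blast
    obtain h2 where h2: "arc h2" "pathstart h2 = p c" "pathfinish h2 = p b" "path_image h2 = ?im {c, b}"
      using oriented[OF cE(2)[OF c]] by blast
    note h = h1 h2
    have i: "{a, c} \<inter> {c, b} = {c}" and ne: "{a, c} \<noteq> {c, b}"
      using cV[OF c] \<open>a \<noteq> b\<close> by (auto simp: doubleton_eq_iff)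
    have "path_image h1 \<inter> path_image h2 \<subseteq> {pathstart h2}"
      using meet[OF cE[OF c] ne] unfolding i h by simp
    then show ?thesis using h
      by (intro exI[of _ "h1 +++ h2"]) (simp add: arc_join path_image_join)
  qed
  have "\<exists>g. \<forall>c\<in>T. arc (g c) \<and> pathstart (g c) = p a \<and> pathfinish (g c) = p b
    \<and> path_image (g c) = ?im {a, c} \<union> ?im {c, b}"
    by (rule bchoice) (use joined in blast)
  then obtain g where "\<forall>c\<in>T. arc (g c) \<and> pathstart (g c) = p a \<and> pathfinish (g c) = p b
    \<and> path_image (g c) = ?im {a, c} \<union> ?im {c, b}"
    by blast
  then have g: "arc (g c)" "pathstart (g c) = p a" "pathfinish (g c) = p b"
    "path_image (g c) = ?im {a, c} \<union> ?im {c, b}" if "c \<in> T" for c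
    using that by auto
  have gmeet: "path_image (g c) \<inter> path_image (g c') = {p a, p b}"
    if "c \<in> T" "c' \<in> T" "c \<noteq> c'" for c c'
  proof
    have sub: "?im e \<inter> ?im e' \<subseteq> {p a, p b}"
      if "e \<in> {{a, c}, {c, b}}" "e' \<in> {{a, c'}, {c', b}}" for e e'
    proof -
      have "e \<noteq> e'" "e \<inter> e' \<subseteq> {a, b}"
        using that \<open>c \<noteq> c'\<close> cV[OF \<open>c \<in> T\<close>] cV[OF \<open>c' \<in> T\<close>] \<open>a \<noteq> b\<close>
        by (auto simp: doubleton_eq_iff)
      moreover have "e \<in> E" "e' \<in> E" using that cE \<open>c \<in> T\<close> \<open>c' \<in> T\<close> by auto
      ultimately show ?thesis using meet[of e e'] by blast
    qed
    show "path_image (g c) \<inter> path_image (g c') \<subseteq> {p a, p b}"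
      unfolding g(4)[OF \<open>c \<in> T\<close>] g(4)[OF \<open>c' \<in> T\<close>] Int_Un_distrib Int_Un_distrib2
      by (intro Un_least sub) auto
    show "{p a, p b} \<subseteq> path_image (g c) \<inter> path_image (g c')"
      using g(2,3) that by (metis Int_iff empty_subsetI insert_subset pathfinish_in_path_image pathstart_in_path_image)
  qed
  have pc: "p c \<in> path_image (g c) - {p a, p b}" if c: "c \<in> T" for c
  proof -
    have "p c \<in> ?im {a, c}"
      using ends[OF cE(1)[OF c]] pathstart_in_path_image[of "\<gamma> {a, c}"]
        pathfinish_in_path_image[of "\<gamma> {a, c}"] by (auto simp: doubleton_eq_iff)
    moreover have "p c \<noteq> p a" "p c \<noteq> p b"
      using cV[OF c] ab inj by (auto dest: inj_onD)
    ultimately show ?thesis using g(4)[OF c] by auto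
  qed
  let ?D = "p ` V \<union> (\<Union>e\<in>E. ?im e)"
  have sub: "path_image (g c) \<subseteq> ?D" if "c \<in> T" for c
    using g(4)[OF that] cE[OF that] by auto
  have "\<not> {p c1, p c2, p c3} \<subseteq> closure (outside ?D)"
    by (rule theta_curve_interior_points[OF g(1)[OF mem(1)] g(1)[OF mem(2)] g(1)[OF mem(3)]
        g(2,3)[OF mem(1)] g(2,3)[OF mem(2)] g(2,3)[OF mem(3)]
        gmeet[OF mem(1,2) dist(1)] gmeet[OF mem(1,3) dist(2)] gmeet[OF mem(2,3) dist(3)]
        pc[OF mem(1)] pc[OF mem(2)] pc[OF mem(3)]])
      (intro Un_least sub mem)
  then show False
    using outer cV(1)[OF mem(1)] cV(1)[OF mem(2)] cV(1)[OF mem(3)] by simp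
qed

section \<open>Stars\<close>

definition star_edges :: "'a set \<Rightarrow> 'a \<Rightarrow> 'a set set" where
  "star_edges V c = (\<lambda>u. {u, c}) ` (V - {c})"

lemma star_edges_iff:
  "{u, v} \<in> star_edges V c \<longleftrightarrow> (u = c \<and> v \<in> V - {c}) \<or> (v = c \<and> u \<in> V - {c})"
  by (auto simp: star_edges_def doubleton_eq_iff)

lemma simple_graph_star: "finite V \<Longrightarrow> c \<in> V \<Longrightarrow> simple_graph V (star_edges V c)"
  by (auto simp: simple_graph_def star_edges_def)

lemma connected_graph_star:
  assumes "c \<in> V"
  shows "connected_graph V (star_edges V c)"
proof -
  let ?R = "{(x, y). {x, y} \<in> star_edges V c}"
  have "(u, c) \<in> ?R\<^sup>*" "(c, u) \<in> ?R\<^sup>*" if "u \<in> V" for u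
    using that by (cases "u = c"; auto simp: star_edges_iff intro!: r_into_rtrancl)+
  then show ?thesis
    using assms by (auto simp: connected_graph_def intro: rtrancl_trans)
qed

lemma Q_eigenvalue_star:
  assumes "finite V" "c \<in> V" "card V \<ge> 2"
  shows "Q_eigenvalue V (star_edges V c) (real (card V))"
proof -
  \<comment> \<open>With n = \<open>card V\<close>, the equation at the centre reads (n-1)(n-1) +
    (n-1) = n(n-1), and at a leaf 1 + (n-1) = n.\<close>
  let ?x = "\<lambda>v. if v = c then real (card V) - 1 else 1"
  have c: "{u \<in> V. {u, c} \<in> star_edges V c} = V - {c}"
    by (auto simp: star_edges_iff)
  have v: "{u \<in> V. {u, v} \<in> star_edges V c} = {c}" if "v \<in> V" "v \<noteq> c" for v
    using that assms by (auto simp: star_edges_iff)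
  have sum: "(\<Sum>u\<in>V - {c}. ?x u) = real (card V) - 1"
    using assms by (simp add: of_nat_diff)
  have "real (Defs.degree V (star_edges V c) v) * ?x v
      + (\<Sum>u\<in>{u \<in> V. {u, v} \<in> star_edges V c}. ?x u) = real (card V) * ?x v"
    if "v \<in> V" for v
  proof (cases "v = c")
    case True
    then show ?thesis
      using assms unfolding Defs.degree_def True c sum by (simp add: of_nat_diff algebra_simps)
  next
    case False
    then show ?thesis
      unfolding Defs.degree_def v[OF that False] by simp
  qed
  moreover have "?x c \<noteq> 0" using assms by auto
  ultimately show ?thesis
    unfolding Q_eigenvalue_def using assms(2) by (intro exI[of _ ?x]) blast
qed

text \<open>Any two edges of a star share its centre, whereas an injective map keeps disjoint edges
  disjoint.\<close>

lemma not_contains_subgraph_star: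
  assumes "{i, j} \<in> EF" "{k, l} \<in> EF" "{i, j, k, l} \<subseteq> VF" "{i, j} \<inter> {k, l} = {}"
  shows "\<not> contains_subgraph VF EF V (star_edges V c)"
proof
  assume "contains_subgraph VF EF V (star_edges V c)"
  then obtain f where f: "inj_on f VF" "\<forall>e\<in>EF. f ` e \<in> star_edges V c"
    by (auto simp: contains_subgraph_def)
  then have "{f i, f j} \<in> star_edges V c" "{f k, f l} \<in> star_edges V c"
    using assms(1,2) by force+
  then have "c \<in> f ` {i, j} \<inter> f ` {k, l}"
    by (auto simp: star_edges_iff)
  then have "c \<in> f ` ({i, j} \<inter> {k, l})"
    using assms(3) inj_on_image_Int[OF f(1), of "{i, j}" "{k, l}"] by simp
  then show False using assms(4) by simp
qed

section \<open>Drawing a star with chords of the unit circle\<close>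

lemma open_segment_sphere:
  fixes a b :: "'a::euclidean_space"
  assumes "norm a = 1" "norm b = 1" "x \<in> open_segment a b"
  shows "norm x < 1"
  using dist_decreases_open_segment[OF assms(3), of 0] assms by auto

text \<open>A second common point would put \<open>a\<close> and \<open>b\<close> on the same ray
  from \<open>c\<close>. The nearer of the two would then lie strictly inside the chord to the
  other, where the norm is less than 1.\<close>

lemma chords_from_common_point:
  fixes a b c :: "'a::euclidean_space"
  assumes "norm a = 1" "norm b = 1" "norm c = 1" "a \<noteq> b"
  shows "closed_segment c a \<inter> closed_segment c b \<subseteq> {c}"
proof
  fix z assume z: "z \<in> closed_segment c a \<inter> closed_segment c b"
  show "z \<in> {c}"
  proof (rule ccontr)
    assume "z \<notin> {c}"
    have key: False if "a' \<in> open_segment c b'" "norm a' = 1" "norm b' = 1" for a' b'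
      using open_segment_sphere[OF assms(3) that(3,1)] that(2) by simp
    obtain s where "0 \<le> s" "s \<le> 1" "z = (1 - s) *\<^sub>R c + s *\<^sub>R a"
      using z by (auto simp: in_segment)
    then have s: "0 \<le> s" "s \<le> 1" "z = c + s *\<^sub>R (a - c)" by (simp_all add: algebra_simps)
    obtain t where "0 \<le> t" "t \<le> 1" "z = (1 - t) *\<^sub>R c + t *\<^sub>R b"
      using z by (auto simp: in_segment)
    then have t: "0 \<le> t" "t \<le> 1" "z = c + t *\<^sub>R (b - c)" by (simp_all add: algebra_simps)
    have pos: "s > 0" "t > 0" using s t \<open>z \<notin> {c}\<close> by (cases "s = 0"; cases "t = 0"; simp)+
    have st: "s *\<^sub>R (a - c) = t *\<^sub>R (b - c)" using s t by simp
    have ac: "a \<noteq> c" "b \<noteq> c" using s t \<open>z \<notin> {c}\<close> by auto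
    \<comment> \<open>The chord with the smaller parameter is the longer one and contains the end
      point of the other.\<close>
    have "s \<noteq> t" using st pos \<open>a \<noteq> b\<close> by auto
    then consider "s < t" | "t < s" by linarith
    then show False
    proof cases
      case 1
      have "(1/t) *\<^sub>R (s *\<^sub>R (a - c)) = (1/t) *\<^sub>R (t *\<^sub>R (b - c))" using st by simp
      then have "b = (1 - s/t) *\<^sub>R c + (s/t) *\<^sub>R a"
        using pos by (simp add: algebra_simps)
      then have "b \<in> open_segment c a"
        using ac 1 pos by (auto simp: in_segment intro!: exI[of _ "s/t"])
      then show False using key assms by blast
    next
      case 2
      have "(1/s) *\<^sub>R (s *\<^sub>R (a - c)) = (1/s) *\<^sub>R (t *\<^sub>R (b - c))" using st by simp
      then have "a = (1 - t/s) *\<^sub>R c + (t/s) *\<^sub>R b"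
        using pos by (simp add: algebra_simps)
      then have "a \<in> open_segment c b"
        using ac 2 pos by (auto simp: in_segment intro!: exI[of _ "t/s"])
      then show False using key assms by blast
    qed
  qed
qed

lemma infinite_unit_circle: "infinite (sphere (0::complex) 1)"
proof -
  have "infinite (cis ` {0..1})"
  proof -
    have "inj_on cis {0..1}"
    proof (rule inj_onI)
      fix x y :: real assume xy: "x \<in> {0..1}" "y \<in> {0..1}" "cis x = cis y"
      have "x \<le> pi" "y \<le> pi" using xy(1,2) pi_gt3 unfolding atLeastAtMost_iff by linarith+
      moreover have "cos x = cos y" using arg_cong[OF xy(3), of Re] by simp
      ultimately show "x = y" using cos_inj_pi[of x y] xy(1,2) by (simp only: atLeastAtMost_iff)
    qed
    then show ?thesis by (simp add: finite_image_iff)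
  qed
  moreover have "cis ` {0..1} \<subseteq> sphere 0 1" by auto
  ultimately show ?thesis using finite_subset by blast
qed

text \<open>The complement of the closed disc is contained in \<open>outside D\<close>, and its
  closure contains the unit circle.\<close>

lemma closure_outside_unit_disc:
  fixes z :: complex
  assumes "D \<subseteq> cball 0 1" "norm z = 1"
  shows "z \<in> closure (outside D)"
proof -
  have "- cball 0 1 \<subseteq> outside D"
    using outside_mono[OF assms(1)] outside_convex[of "cball (0::complex) 1"] by simp
  then have "closure (- cball 0 1) \<subseteq> closure (outside D)" by (rule closure_mono)
  moreover have "z \<in> closure (- cball 0 1)"
    using assms(2) by (simp add: closure_complement)
  ultimately show ?thesis by blast
qed

text \<open>All vertices, the centre included, are placed on the unit circle and the edges are
  chords from \<open>p c\<close>. Chords touch the circle only in their end points and meet each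
  other only in \<open>p c\<close>; the drawing stays in the disc, so every vertex is on the outer
  face.\<close>

lemma outerplanar_star:
  assumes "finite V" "c \<in> V"
  shows "outerplanar V (star_edges V c)"
proof -
  obtain B where B: "B \<subseteq> sphere (0::complex) 1" "finite B" "card B = card V"
    using infinite_arbitrarily_large[OF infinite_unit_circle] by metis
  then obtain p where p: "bij_betw p V B"
    using finite_same_card_bij[OF assms(1)] by metis
  have n1: "norm (p v) = 1" if "v \<in> V" for v
    using p B that by (auto simp: bij_betw_def)
  have injp: "inj_on p V" using p by (simp add: bij_betw_def)
  \<comment> \<open>The description picks the leaf of the edge, so that every chord starts at
    \<open>p c\<close>.\<close>
  define \<gamma> where "\<gamma> e = linepath (p c) (p (THE u. u \<in> e \<and> u \<noteq> c))" for e
  have \<gamma>: "\<gamma> {u, c} = linepath (p c) (p u)" if "u \<in> V - {c}" for u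
  proof -
    have "(THE w. w \<in> {u, c} \<and> w \<noteq> c) = u" using that by (intro the_equality) auto
    then show ?thesis by (simp add: \<gamma>_def)
  qed
  let ?E = "star_edges V c"
  have ne: "p c \<noteq> p u" if "u \<in> V - {c}" for u
    using that injp assms by (auto dest: inj_onD)
  have *: "arc (\<gamma> e) \<and> {pathstart (\<gamma> e), pathfinish (\<gamma> e)} = p ` e
    \<and> path_image (\<gamma> e) \<inter> p ` V = p ` e" if "e \<in> ?E" for e
  proof -
    obtain u where u: "e = {u, c}" "u \<in> V - {c}" using \<open>e \<in> ?E\<close> by (auto simp: star_edges_def)
    have "closed_segment (p c) (p u) \<inter> p ` V \<subseteq> p ` e"
    proof
      fix x assume x: "x \<in> closed_segment (p c) (p u) \<inter> p ` V"
      then have "norm x = 1" using n1 by auto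
      then have "x \<notin> open_segment (p c) (p u)"
        using open_segment_sphere[of "p c" "p u" x] n1 assms u by auto
      then show "x \<in> p ` e" using x u by (auto simp: open_segment_def)
    qed
    moreover have "p ` e \<subseteq> closed_segment (p c) (p u) \<inter> p ` V" using u assms by auto
    ultimately have "closed_segment (p c) (p u) \<inter> p ` V = p ` e" by (rule equalityI)
    then show ?thesis
      unfolding u(1) \<gamma>[OF u(2)] using ne[OF u(2)] by (auto simp: insert_commute)
  qed
  have **: "path_image (\<gamma> e) \<inter> path_image (\<gamma> e') \<subseteq> p ` (e \<inter> e')"
    if E: "e \<in> ?E" "e' \<in> ?E" "e \<noteq> e'" for e e'
  proof -
    obtain u where u: "e = {u, c}" "u \<in> V - {c}" using \<open>e \<in> ?E\<close> by (auto simp: star_edges_def)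
    obtain u' where u': "e' = {u', c}" "u' \<in> V - {c}" using \<open>e' \<in> ?E\<close> by (auto simp: star_edges_def)
    have "u \<noteq> u'" using E u u' by auto
    then have "p u \<noteq> p u'" using injp u u' by (auto dest: inj_onD)
    then have "closed_segment (p c) (p u) \<inter> closed_segment (p c) (p u') \<subseteq> {p c}"
      using n1 u u' assms by (intro chords_from_common_point) auto
    then show ?thesis
      unfolding u(1) u'(1) \<gamma>[OF u(2)] \<gamma>[OF u'(2)] by auto
  qed
  have "p ` V \<union> (\<Union>e\<in>?E. path_image (\<gamma> e)) \<subseteq> cball 0 1"
  proof -
    have "path_image (\<gamma> e) \<subseteq> cball 0 1" if "e \<in> ?E" for e
    proof -
      obtain u where u: "e = {u, c}" "u \<in> V - {c}" using \<open>e \<in> ?E\<close> by (auto simp: star_edges_def)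
      show ?thesis
        unfolding u(1) \<gamma>[OF u(2)] path_image_linepath
        using n1 u assms by (intro closed_segment_subset) auto
    qed
    then show ?thesis using n1 by auto
  qed
  then have outer: "\<forall>v\<in>V. p v \<in> closure (outside (p ` V \<union> (\<Union>e\<in>?E. path_image (\<gamma> e))))"
    using n1 closure_outside_unit_disc by blast
  show ?thesis
    unfolding outerplanar_def using injp * ** outer by (intro exI[of _ p] exI[of _ \<gamma>]) simp
qed

text \<open>Two disjoint edges are exhibited. The second one next to {0, 1} is {2, 3}, except for
  \<open>l = 3\<close>: there a block ends at vertex 2 and {3, 4} takes its place. The bound
  \<open>5 \<le> t * l\<close> ensures that vertex 4 exists.\<close>

lemma path_forest_not_in_star:
  assumes "1 \<le> t" "2 \<le> l" "5 \<le> t * l" "(VF, EF) = path_forest t l"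
  shows "\<not> contains_subgraph VF EF V (star_edges V c)"
proof -
  have VF: "VF = {0..<t * l}" and EF: "EF = {{i, Suc i} | i. Suc i < t * l \<and> Suc i mod l \<noteq> 0}"
    using assms(4) by (auto simp: path_forest_def)
  have edge: "{i, Suc i} \<in> EF" if "Suc i < t * l" "Suc i mod l \<noteq> 0" for i
    using that EF by blast
  have e0: "{0, 1} \<in> EF" using edge[of 0] assms by simp
  show ?thesis
  proof (cases "l = 3")
    case True
    then have "{3, 4} \<in> EF" using edge[of 3] assms by simp
    with e0 show ?thesis
      using assms by (intro not_contains_subgraph_star[of 0 1 EF 3 4]) (auto simp: VF)
  next
    case False
    have "3 mod l \<noteq> 0"
    proof (cases "l = 2")
      case False
      then have "l > 3" using \<open>l \<noteq> 3\<close> assms by simp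
      then show ?thesis by simp
    qed simp
    then have "{2, 3} \<in> EF" using edge[of 2] assms by (simp add: numeral_3_eq_3)
    with e0 show ?thesis
      using assms by (intro not_contains_subgraph_star[of 0 1 EF 2 3]) (auto simp: VF)
  qed
qed

lemma cycle_graph_not_in_star:
  assumes "l \<ge> 4" "(VF, EF) = cycle_graph l"
  shows "\<not> contains_subgraph VF EF V (star_edges V c)"
proof -
  have VF: "VF = {0..<l}" and EF: "EF = {{i, Suc i mod l} | i. i < l}"
    using assms(2) by (auto simp: cycle_graph_def)
  have edge: "{i, Suc i} \<in> EF" if "Suc i < l" for i
    unfolding EF using that by (intro CollectI exI[of _ i]) auto
  have "{0, 1} \<in> EF" "{2, 3} \<in> EF" using edge[of 0] edge[of 2] assms by (simp_all add: numeral_3_eq_3)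
  then show ?thesis
    using assms by (intro not_contains_subgraph_star[of 0 1 EF 2 3]) (auto simp: VF)
qed

section \<open>Eigenvalues of the signless Laplacian\<close>

text \<open>Numbering the vertices turns functions on \<open>V\<close> into vectors and so gives
  access to results on spectra of matrices. The entries are complex so that an eigenvalue exists by
  algebraic closedness.\<close>

lemma signless_Laplacian_matrix:
  fixes V :: "'a set" and E :: "'a set set"
  assumes "finite V"
  shows "\<exists>A :: complex mat. A \<in> carrier_mat (card V) (card V) \<and>
    (\<forall>\<mu>. eigenvalue A \<mu> \<longleftrightarrow> (\<exists>x. (\<exists>v\<in>V. x v \<noteq> 0) \<and>
      (\<forall>v\<in>V. of_nat (Defs.degree V E v) * x v + (\<Sum>u\<in>{u \<in> V. {u, v} \<in> E}. x u) = \<mu> * x v)))"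
proof -
  let ?n = "card V"
  obtain b where b: "bij_betw b {0..<?n} V"
    using ex_bij_betw_nat_finite[OF assms] by blast
  have bV: "b i \<in> V" if "i < ?n" for i
    using b that by (auto simp: bij_betw_def)
  have Vb: "\<exists>i<?n. v = b i" if "v \<in> V" for v
    using b that by (force simp: bij_betw_def)
  have all: "(\<forall>i<?n. P (b i)) \<longleftrightarrow> (\<forall>v\<in>V. P v)" for P
    using bV Vb by blast
  define A :: "complex mat" where "A = mat ?n ?n (\<lambda>(i, j).
    (if i = j then of_nat (Defs.degree V E (b i)) else 0) + (if {b j, b i} \<in> E then 1 else 0))"
  let ?Q = "\<lambda>x v. of_nat (Defs.degree V E v) * x v + (\<Sum>u\<in>{u \<in> V. {u, v} \<in> E}. x u) :: complex"
  have A: "A \<in> carrier_mat ?n ?n" by (simp add: A_def)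
  have row: "(A *\<^sub>v vec ?n (\<lambda>i. x (b i))) $ i = ?Q x (b i)" if "i < ?n" for x i
  proof -
    have "(A *\<^sub>v vec ?n (\<lambda>i. x (b i))) $ i = (\<Sum>j\<in>{0..<?n}. A $$ (i, j) * x (b j))"
      using that A by (simp add: scalar_prod_def)
    also have "\<dots> = (\<Sum>j\<in>{0..<?n}. (if i = j then of_nat (Defs.degree V E (b i)) * x (b j) else 0)
        + (if {b j, b i} \<in> E then x (b j) else 0))"
      using that by (intro sum.cong) (auto simp: A_def algebra_simps)
    also have "\<dots> = of_nat (Defs.degree V E (b i)) * x (b i)
        + (\<Sum>j\<in>{0..<?n}. if {b j, b i} \<in> E then x (b j) else 0)"
      using that by (simp add: sum.distrib)
    also have "(\<Sum>j\<in>{0..<?n}. if {b j, b i} \<in> E then x (b j) else 0)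
        = (\<Sum>u\<in>V. if {u, b i} \<in> E then x u else 0)"
      using sum.reindex_bij_betw[OF b, of "\<lambda>u. if {u, b i} \<in> E then x u else 0"] .
    also have "\<dots> = (\<Sum>u\<in>{u \<in> V. {u, b i} \<in> E}. x u)"
      using assms by (simp add: sum.inter_filter)
    finally show ?thesis .
  qed
  have ev: "eigenvector A (vec ?n (\<lambda>i. x (b i))) \<mu> \<longleftrightarrow> (\<exists>v\<in>V. x v \<noteq> 0) \<and> (\<forall>v\<in>V. ?Q x v = \<mu> * x v)" for x \<mu>
  proof -
    have "vec ?n (\<lambda>i. x (b i)) \<noteq> 0\<^sub>v ?n \<longleftrightarrow> (\<exists>v\<in>V. x v \<noteq> 0)"
      using bV Vb by (auto simp: vec_eq_iff)
    moreover have "A *\<^sub>v vec ?n (\<lambda>i. x (b i)) = \<mu> \<cdot>\<^sub>v vec ?n (\<lambda>i. x (b i))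
        \<longleftrightarrow> (\<forall>i<?n. ?Q x (b i) = \<mu> * x (b i))"
      using A row by (auto simp: vec_eq_iff)
    moreover have "\<dots> \<longleftrightarrow> (\<forall>v\<in>V. ?Q x v = \<mu> * x v)"
      by (rule all)
    ultimately show ?thesis
      using A by (simp add: eigenvector_def)
  qed
  have "\<exists>x. v = vec ?n (\<lambda>i. x (b i))" if "v \<in> carrier_vec ?n" for v :: "complex vec"
  proof
    show "v = vec ?n (\<lambda>i. (\<lambda>u. v $ (the_inv_into {0..<?n} b u)) (b i))"
      using that b by (intro eq_vecI) (auto simp: bij_betw_def the_inv_into_f_f)
  qed
  then have eq: "eigenvalue A \<mu> \<longleftrightarrow> (\<exists>x. eigenvector A (vec ?n (\<lambda>i. x (b i))) \<mu>)" for \<mu>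
    unfolding eigenvalue_def using A by (metis carrier_matD(1) eigenvector_def)
  show ?thesis
    by (intro exI[of _ A] conjI allI A) (simp only: eq ev)
qed

text \<open>The real eigenvalues embed into the finite complex spectrum. Together with the existence
  of an eigenvalue this makes the \<open>Max\<close> in \<open>Q_index\<close> a genuine
  maximum.\<close>

lemma finite_Q_eigenvalues:
  assumes "finite V"
  shows "finite {\<mu>. Q_eigenvalue V E \<mu>}"
proof -
  obtain A :: "complex mat" where A: "A \<in> carrier_mat (card V) (card V)" and
    ev: "\<And>\<mu>. eigenvalue A \<mu> \<longleftrightarrow> (\<exists>x. (\<exists>v\<in>V. x v \<noteq> 0) \<and>
      (\<forall>v\<in>V. of_nat (Defs.degree V E v) * x v + (\<Sum>u\<in>{u \<in> V. {u, v} \<in> E}. x u) = \<mu> * x v))"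
    using signless_Laplacian_matrix[OF assms, of E] by auto
  have "of_real \<mu> \<in> spectrum A" if \<mu>: "Q_eigenvalue V E \<mu>" for \<mu>
  proof -
    from \<mu> obtain x :: "'a \<Rightarrow> real" where x: "\<exists>v\<in>V. x v \<noteq> 0" "\<And>v. v \<in> V \<Longrightarrow>
      real (Defs.degree V E v) * x v + (\<Sum>u\<in>{u \<in> V. {u, v} \<in> E}. x u) = \<mu> * x v"
      unfolding Q_eigenvalue_def by auto
    have "of_nat (Defs.degree V E v) * complex_of_real (x v)
        + (\<Sum>u\<in>{u \<in> V. {u, v} \<in> E}. complex_of_real (x u)) = of_real \<mu> * of_real (x v)"
      if "v \<in> V" for v
      using arg_cong[OF x(2)[OF that], of complex_of_real] by simp
    with x(1) have "eigenvalue A (of_real \<mu>)"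
      unfolding ev by (intro exI[of _ "\<lambda>v. complex_of_real (x v)"]) simp
    then show ?thesis by (simp add: spectrum_def)
  qed
  then have "complex_of_real ` {\<mu>. Q_eigenvalue V E \<mu>} \<subseteq> spectrum A" by blast
  then have "finite (complex_of_real ` {\<mu>. Q_eigenvalue V E \<mu>})"
    using card_finite_spectrum(1)[OF A] by (rule finite_subset)
  then show ?thesis
    by (rule finite_imageD) (auto intro: inj_onI)
qed

text \<open>A complex eigenvalue exists and is real because the matrix is Hermitian. The real and
  imaginary parts of its eigenvector both satisfy the real equations, and one of them is
  nonzero.\<close>

lemma Q_eigenvalue_exists:
  assumes "finite V" "V \<noteq> {}"
  shows "\<exists>\<mu>. Q_eigenvalue V E \<mu>"
proof -
  obtain A :: "complex mat" where A: "A \<in> carrier_mat (card V) (card V)" and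
    ev: "\<And>\<mu>. eigenvalue A \<mu> \<longleftrightarrow> (\<exists>x. (\<exists>v\<in>V. x v \<noteq> 0) \<and>
      (\<forall>v\<in>V. of_nat (Defs.degree V E v) * x v + (\<Sum>u\<in>{u \<in> V. {u, v} \<in> E}. x u) = \<mu> * x v))"
    using signless_Laplacian_matrix[OF assms(1), of E] by auto
  have "card V \<noteq> 0" using assms by simp
  then obtain \<zeta> where "eigenvalue A \<zeta>"
    using spectrum_non_empty[OF A] by (auto simp: spectrum_def)
  then obtain x where x0: "\<exists>v\<in>V. x v \<noteq> 0" and x: "\<And>v. v \<in> V \<Longrightarrow>
      of_nat (Defs.degree V E v) * x v + (\<Sum>u\<in>{u \<in> V. {u, v} \<in> E}. x u) = \<zeta> * x v"
    unfolding ev by auto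
  let ?N = "\<lambda>v. {u \<in> V. {u, v} \<in> E}"
  \<comment> \<open>\<open>N\<close> is the squared norm of \<open>x\<close>; \<open>D\<close> and
    \<open>S\<close> are the diagonal and the adjacency part of the Hermitian form at
    \<open>x\<close>. All three equal their conjugates, \<open>S\<close> because edges are
    unordered.\<close>
  define N where "N = (\<Sum>v\<in>V. x v * cnj (x v))"
  define D where "D = (\<Sum>v\<in>V. of_nat (Defs.degree V E v) * (x v * cnj (x v)))"
  define S where "S = (\<Sum>v\<in>V. \<Sum>u\<in>V. if {u, v} \<in> E then x u * cnj (x v) else 0)"
  have inner: "(\<Sum>u\<in>?N v. x u) * cnj (x v) = (\<Sum>u\<in>V. if {u, v} \<in> E then x u * cnj (x v) else 0)" for v
    unfolding sum_distrib_right using assms(1) by (simp add: sum.inter_filter)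
  have "\<zeta> * N = (\<Sum>v\<in>V. (of_nat (Defs.degree V E v) * x v + (\<Sum>u\<in>?N v. x u)) * cnj (x v))"
    unfolding N_def sum_distrib_left using x by (intro sum.cong) (auto simp: mult.assoc)
  also have "\<dots> = D + S"
    unfolding D_def S_def distrib_right inner sum.distrib by (simp add: mult.assoc)
  finally have \<zeta>N: "\<zeta> * N = D + S" .
  have "cnj S = (\<Sum>v\<in>V. \<Sum>u\<in>V. if {u, v} \<in> E then x v * cnj (x u) else 0)"
    unfolding S_def cnj_sum by (intro sum.cong) auto
  also have "\<dots> = S"
    unfolding S_def by (subst sum.swap) (intro sum.cong, auto simp: insert_commute)
  finally have "cnj S = S" .
  moreover have "cnj N = N" "cnj D = D"
    unfolding N_def D_def cnj_sum by (simp_all add: mult.commute)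
  moreover have "cnj \<zeta> * cnj N = cnj D + cnj S" using arg_cong[OF \<zeta>N, of cnj] by simp
  ultimately have "cnj \<zeta> * N = \<zeta> * N" using \<zeta>N by simp
  moreover have "N \<noteq> 0"
  proof -
    have "N = of_real (\<Sum>v\<in>V. (norm (x v))\<^sup>2)"
      unfolding N_def of_real_sum by (intro sum.cong) (simp_all only: complex_norm_square)
    moreover have "(\<Sum>v\<in>V. (norm (x v))\<^sup>2) \<noteq> 0"
      using x0 assms(1) by (subst sum_nonneg_eq_0_iff) auto
    ultimately show ?thesis by (simp only: of_real_eq_0_iff not_False_eq_True)
  qed
  ultimately have "cnj \<zeta> = \<zeta>" by simp
  then have \<zeta>: "\<zeta> = of_real (Re \<zeta>)" by (simp add: complex_eq_iff)
  have xr: "of_nat (Defs.degree V E v) * x v + (\<Sum>u\<in>?N v. x u) = of_real (Re \<zeta>) * x v"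
    if "v \<in> V" for v
    using x[OF that] \<zeta> by simp
  have re: "real (Defs.degree V E v) * Re (x v) + (\<Sum>u\<in>?N v. Re (x u)) = Re \<zeta> * Re (x v)"
    if "v \<in> V" for v
    using arg_cong[OF xr[OF that], of Re] by simp
  have im: "real (Defs.degree V E v) * Im (x v) + (\<Sum>u\<in>?N v. Im (x u)) = Re \<zeta> * Im (x v)"
    if "v \<in> V" for v
    using arg_cong[OF xr[OF that], of Im] by simp
  have "Q_eigenvalue V E (Re \<zeta>)"
  proof (cases "\<exists>v\<in>V. Re (x v) \<noteq> 0")
    case True
    then show ?thesis
      unfolding Q_eigenvalue_def using re by (intro exI[of _ "\<lambda>v. Re (x v)"]) simp
  next
    case False
    then have "\<exists>v\<in>V. Im (x v) \<noteq> 0" using x0 by (auto simp: complex_eq_iff)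
    then show ?thesis
      unfolding Q_eigenvalue_def using im by (intro exI[of _ "\<lambda>v. Im (x v)"]) simp
  qed
  then show ?thesis ..
qed

lemma Q_index_eigenvalue:
  assumes "finite V" "V \<noteq> {}"
  shows "Q_eigenvalue V E (Q_index V E)"
  using Max_in[OF finite_Q_eigenvalues[OF assms(1), of E]] Q_eigenvalue_exists[OF assms, of E]
  unfolding Q_index_def by blast

lemma Q_eigenvalue_le_Q_index:
  assumes "finite V" "Q_eigenvalue V E \<mu>"
  shows "\<mu> \<le> Q_index V E"
  unfolding Q_index_def using assms finite_Q_eigenvalues by (intro Max_ge) auto

section \<open>Graphs without $K_{2,3}$ and without a dominating vertex\<close>

text \<open>\<open>z\<close> stands for the absolute values of an eigenvector for the eigenvalue
  \<open>L\<close>, scaled to have maximum 1 at \<open>c\<close>. The triangle inequality turns the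
  eigenvalue equations into the inequalities \<open>row\<close>. The goal is that \<open>c\<close>
  is adjacent to all other vertices.\<close>

locale normalized_subeigenvector =
  fixes V :: "'a set" and E :: "'a set set" and z :: "'a \<Rightarrow> real" and L :: real and c :: 'a
  assumes simple: "simple_graph V E"
    and codegree: "\<And>a b. a \<noteq> b \<Longrightarrow> card {u \<in> V. {u, a} \<in> E \<and> {u, b} \<in> E} \<le> 2"
    and order: "9 \<le> card V" "real (card V) \<le> L"
    and c: "c \<in> V" "z c = 1"
    and z: "\<And>v. v \<in> V \<Longrightarrow> 0 \<le> z v" "\<And>v. v \<in> V \<Longrightarrow> z v \<le> 1"
    and row: "\<And>v. v \<in> V \<Longrightarrow>
      (L - real (card {u \<in> V. {u, v} \<in> E})) * z v \<le> (\<Sum>u\<in>{u \<in> V. {u, v} \<in> E}. z u)"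
begin

definition N :: "'a \<Rightarrow> 'a set" where "N v = {u \<in> V. {u, v} \<in> E}"
definition R :: "'a set" where "R = N c"
definition W :: "'a set" where "W = V - R - {c}"
definition d :: nat where "d = card R"
text \<open>Counts the non-neighbours of \<open>c\<close>, with \<open>c\<close> among them;
  \<open>k = 1\<close> says that \<open>c\<close> is adjacent to all other vertices.\<close>

definition k :: nat where "k = card V - d"

lemma fin [simp]: "finite V" "finite (N v)" "finite R" "finite W"
  using simple by (auto simp: simple_graph_def N_def R_def W_def)

lemma N_sym: "u \<in> V \<Longrightarrow> v \<in> V \<Longrightarrow> u \<in> N v \<longleftrightarrow> v \<in> N u"
  by (simp add: N_def insert_commute)

lemma N_irrefl: "v \<notin> N v"
  using simple by (auto simp: N_def simple_graph_def)

lemma N_V: "u \<in> N v \<Longrightarrow> u \<in> V" by (simp add: N_def)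
lemma R_V: "u \<in> R \<Longrightarrow> u \<in> V" by (simp add: R_def N_def)
lemma W_V: "u \<in> W \<Longrightarrow> u \<in> V" by (simp add: W_def)

lemma codegree': "a \<noteq> b \<Longrightarrow> card (N a \<inter> N b) \<le> 2"
  using codegree[of a b] by (simp add: N_def Int_def conj_commute conj_left_commute cong: conj_cong)

lemma row': "v \<in> V \<Longrightarrow> (L - real (card (N v))) * z v \<le> (\<Sum>u\<in>N v. z u)"
  using row[of v] by (simp add: N_def)

lemma sum_z_le:
  assumes "A \<subseteq> V" "\<And>u. u \<in> A \<Longrightarrow> z u \<le> b"
  shows "(\<Sum>u\<in>A. z u) \<le> real (card A) * b"
  using sum_bounded_above[of A z b] assms by simp

lemma V_split: "V = insert c (R \<union> W)" "c \<notin> R \<union> W" "R \<inter> W = {}"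
  using c N_irrefl[of c] by (auto simp: W_def R_def N_def)

lemma card_W: "card W + 1 = k" "d + k = card V"
proof -
  have "card V = 1 + (card R + card W)"
    using V_split by (metis card_Un_disjoint card_insert_disjoint fin(3,4) finite_UnI plus_1_eq_Suc)
  then show "card W + 1 = k" "d + k = card V" by (auto simp: k_def d_def)
qed

text \<open>The leading 1 stands for \<open>c\<close> itself, with \<open>z c = 1\<close>.
  Neighbours of \<open>u\<close> in \<open>R\<close> are common neighbours of \<open>u\<close> and
  \<open>c\<close>, hence at most two.\<close>

lemma N_of_R:
  assumes "u \<in> R"
  shows "N u = insert c ((N u \<inter> R) \<union> (N u \<inter> W))"
    "card (N u) = 1 + card (N u \<inter> R) + card (N u \<inter> W)"
    "(\<Sum>v\<in>N u. z v) = 1 + (\<Sum>v\<in>N u \<inter> R. z v) + (\<Sum>v\<in>N u \<inter> W. z v)"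
    "card (N u \<inter> R) \<le> 2"
proof -
  have "c \<in> N u" using N_sym[of c u] assms c by (auto simp: R_def N_def)
  then show eq: "N u = insert c ((N u \<inter> R) \<union> (N u \<inter> W))"
    using V_split(1) N_V by blast
  have disj: "c \<notin> (N u \<inter> R) \<union> (N u \<inter> W)" "(N u \<inter> R) \<inter> (N u \<inter> W) = {}"
    using V_split by auto
  have "card (N u) = Suc (card ((N u \<inter> R) \<union> (N u \<inter> W)))"
    by (subst eq) (use disj in simp)
  then show "card (N u) = 1 + card (N u \<inter> R) + card (N u \<inter> W)"
    using disj by (simp add: card_Un_disjoint)
  have "(\<Sum>v\<in>N u. z v) = z c + (\<Sum>v\<in>(N u \<inter> R) \<union> (N u \<inter> W). z v)"
    by (subst eq) (use disj in simp)
  then show "(\<Sum>v\<in>N u. z v) = 1 + (\<Sum>v\<in>N u \<inter> R. z v) + (\<Sum>v\<in>N u \<inter> W. z v)"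
    using disj c by (simp add: sum.union_disjoint)
  have "u \<noteq> c" using assms V_split by auto
  then show "card (N u \<inter> R) \<le> 2" unfolding R_def by (rule codegree')
qed

text \<open>Here \<open>c\<close> is not a neighbour. At most two neighbours are shared with
  \<open>c\<close>, and \<open>W\<close> has only \<open>k - 2\<close> vertices other than
  \<open>w\<close>.\<close>

lemma N_of_W:
  assumes "w \<in> W"
  shows "card (N w) = card (N w \<inter> R) + card (N w \<inter> W)"
    "(\<Sum>v\<in>N w. z v) = (\<Sum>v\<in>N w \<inter> R. z v) + (\<Sum>v\<in>N w \<inter> W. z v)"
    "card (N w \<inter> R) \<le> 2" "card (N w \<inter> W) + 2 \<le> k"
proof -
  have wV: "w \<in> V" "w \<notin> R" "w \<noteq> c" using assms by (auto simp: W_def)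
  then have "c \<notin> N w" using N_sym[of c w] c by (auto simp: R_def)
  then have eq: "N w = (N w \<inter> R) \<union> (N w \<inter> W)"
    by (auto simp: W_def dest: N_V)
  have disj: "(N w \<inter> R) \<inter> (N w \<inter> W) = {}"
    using V_split by auto
  show "card (N w) = card (N w \<inter> R) + card (N w \<inter> W)"
    by (subst eq) (use disj in \<open>simp add: card_Un_disjoint\<close>)
  show "(\<Sum>v\<in>N w. z v) = (\<Sum>v\<in>N w \<inter> R. z v) + (\<Sum>v\<in>N w \<inter> W. z v)"
    by (subst eq) (use disj in \<open>simp add: sum.union_disjoint\<close>)
  show "card (N w \<inter> R) \<le> 2" unfolding R_def using wV by (intro codegree')
  have "N w \<inter> W \<subseteq> W - {w}" using N_irrefl[of w] by auto
  then have "card (N w \<inter> W) \<le> card (W - {w})" by (intro card_mono) auto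
  moreover have "card (W - {w}) + 1 = card W"
    using assms by (metis Suc_eq_plus1 card_Suc_Diff1 fin(4))
  ultimately show "card (N w \<inter> W) + 2 \<le> k" using card_W by linarith
qed

lemma sum_R_ge: "L - real d \<le> (\<Sum>u\<in>R. z u)"
  using row'[OF c(1)] c by (simp add: R_def d_def)

lemma sum_R_le: "(\<Sum>u\<in>R. z u) \<le> real d"
  using sum_z_le[of R 1] R_V z by (auto simp: d_def)

text \<open>The sum of \<open>z\<close> over \<open>R\<close> is at least \<open>L - d\<close>,
  hence at least \<open>k\<close>, and at most \<open>d\<close>.\<close>

lemma k_le_d: "k \<le> d"
proof -
  have "real (card V) \<le> 2 * real d" using sum_R_ge sum_R_le order by linarith
  then show ?thesis using card_W(2) by linarith
qed

section \<open>Adding the inequalities over the neighbours of \<open>c\<close>\<close>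

lemma double_count:
  assumes "A \<subseteq> V" "B \<subseteq> V"
  shows "(\<Sum>u\<in>A. \<Sum>v\<in>N u \<inter> B. f u v) = (\<Sum>v\<in>B. \<Sum>u\<in>N v \<inter> A. f u v)"
proof -
  have "finite A" "finite B" using assms finite_subset fin(1) by blast+
  have "(\<Sum>u\<in>A. \<Sum>v\<in>N u \<inter> B. f u v) = (\<Sum>u\<in>A. \<Sum>v\<in>{v \<in> B. v \<in> N u}. f u v)"
    by (intro sum.cong) auto
  also have "\<dots> = (\<Sum>v\<in>B. \<Sum>u\<in>{u \<in> A. v \<in> N u}. f u v)"
    by (rule sum.swap_restrict) fact+
  also have "\<dots> = (\<Sum>v\<in>B. \<Sum>u\<in>N v \<inter> A. f u v)"
    using assms N_sym by (intro sum.cong) (auto simp: subset_iff)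
  finally show ?thesis .
qed

text \<open>Each row of \<open>R\<close> loses 1 from \<open>L\<close> for the neighbour
  \<open>c\<close>. Edges inside \<open>R\<close> enter twice, through the degrees and through the
  neighbour sums, and each time cost at most twice the sum over \<open>R\<close>; this gives
  \<open>L - 5\<close>. Edges between \<open>R\<close> and \<open>W\<close> are counted from
  \<open>W\<close>, where each vertex has at most two neighbours in \<open>R\<close>.\<close>

lemma sum_of_rows:
  "(L - 5) * (\<Sum>u\<in>R. z u) \<le> real d + (\<Sum>w\<in>W. \<Sum>u\<in>N w \<inter> R. z u) + 2 * (\<Sum>w\<in>W. z w)"
proof -
  let ?h = "\<lambda>u. real (card (N u \<inter> R))"
  have RV: "R \<subseteq> V" "W \<subseteq> V" using R_V W_V by auto
  have "(\<Sum>u\<in>R. (L - 1) * z u - ?h u * z u - (\<Sum>w\<in>N u \<inter> W. z u))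
      \<le> (\<Sum>u\<in>R. 1 + (\<Sum>v\<in>N u \<inter> R. z v) + (\<Sum>w\<in>N u \<inter> W. z w))"
  proof (rule sum_mono)
    fix u assume u: "u \<in> R"
    show "(L - 1) * z u - ?h u * z u - (\<Sum>w\<in>N u \<inter> W. z u)
        \<le> 1 + (\<Sum>v\<in>N u \<inter> R. z v) + (\<Sum>w\<in>N u \<inter> W. z w)"
      using row'[OF R_V[OF u]] N_of_R(2,3)[OF u] by (simp add: algebra_simps)
  qed
  then have main: "(L - 1) * (\<Sum>u\<in>R. z u) - (\<Sum>u\<in>R. ?h u * z u) - (\<Sum>u\<in>R. \<Sum>w\<in>N u \<inter> W. z u)
      \<le> real d + (\<Sum>u\<in>R. \<Sum>v\<in>N u \<inter> R. z v) + (\<Sum>u\<in>R. \<Sum>w\<in>N u \<inter> W. z w)"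
    by (simp add: sum.distrib sum_subtractf sum_distrib_left d_def)
  have "(\<Sum>u\<in>R. \<Sum>v\<in>N u \<inter> R. z v) = (\<Sum>u\<in>R. ?h u * z u)"
    by (subst double_count[OF RV(1,1)]) simp
  moreover have "(\<Sum>u\<in>R. \<Sum>w\<in>N u \<inter> W. z u) = (\<Sum>w\<in>W. \<Sum>u\<in>N w \<inter> R. z u)"
    by (rule double_count[OF RV])
  moreover have "(\<Sum>u\<in>R. ?h u * z u) \<le> 2 * (\<Sum>u\<in>R. z u)"
    unfolding sum_distrib_left using N_of_R(4) z R_V by (intro sum_mono mult_right_mono) auto
  moreover have "(\<Sum>u\<in>R. \<Sum>w\<in>N u \<inter> W. z w) \<le> 2 * (\<Sum>w\<in>W. z w)"
  proof -
    have "(\<Sum>u\<in>R. \<Sum>w\<in>N u \<inter> W. z w) = (\<Sum>w\<in>W. real (card (N w \<inter> R)) * z w)"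
      by (subst double_count[OF RV]) simp
    also have "\<dots> \<le> 2 * (\<Sum>w\<in>W. z w)"
      unfolding sum_distrib_left using N_of_W(3) z W_V by (intro sum_mono mult_right_mono) auto
    finally show ?thesis .
  qed
  ultimately show ?thesis using main by (simp add: algebra_simps)
qed

lemma main_bound:
  "(real (card V) - 5) * real k \<le> real d + (\<Sum>w\<in>W. \<Sum>u\<in>N w \<inter> R. z u) + 2 * (\<Sum>w\<in>W. z w)"
proof -
  have "real k \<le> (\<Sum>u\<in>R. z u)" using sum_R_ge order card_W(2) by linarith
  then have "(real (card V) - 5) * real k \<le> (L - 5) * (\<Sum>u\<in>R. z u)"
    using order by (intro mult_mono) auto
  then show ?thesis using sum_of_rows by linarith
qed

text \<open>The degree of \<open>w\<close> is at most 2 + (k - 2) = k, so the coefficient in its row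
  is at least \<open>d\<close>.\<close>

lemma row_W:
  assumes "w \<in> W"
  shows "real d * z w \<le> (\<Sum>u\<in>N w \<inter> R. z u) + (\<Sum>u\<in>N w \<inter> W. z u)"
proof -
  have "real (card (N w)) + real d \<le> L"
    using N_of_W(1,3,4)[OF assms] card_W(2) order by linarith
  then have "real d * z w \<le> (L - real (card (N w))) * z w"
    using z W_V[OF assms] by (intro mult_right_mono) auto
  then show ?thesis using row'[OF W_V[OF assms]] N_of_W(2)[OF assms] by linarith
qed

lemma sum_N_W_R_le:
  assumes "w \<in> W" "\<And>u. u \<in> N w \<inter> R \<Longrightarrow> z u \<le> b" "0 \<le> b"
  shows "(\<Sum>u\<in>N w \<inter> R. z u) \<le> 2 * b"
proof -
  have "(\<Sum>u\<in>N w \<inter> R. z u) \<le> real (card (N w \<inter> R)) * b"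
    using assms R_V by (intro sum_z_le) auto
  also have "\<dots> \<le> 2 * b"
    using N_of_W(3)[OF assms(1)] assms(3) by (intro mult_right_mono) auto
  finally show ?thesis .
qed

text \<open>Turns a bound \<open>b\<close> on \<open>W\<close> into a new one, to be iterated: at
  most two neighbours in \<open>R\<close> contribute 1 each, and at most \<open>k - 2\<close>
  neighbours in \<open>W\<close> contribute \<open>b\<close> each.\<close>

lemma z_W_improve:
  assumes w: "w \<in> W" and b: "\<And>u. u \<in> W \<Longrightarrow> z u \<le> b"
  shows "real d * z w \<le> 2 + (real k - 2) * b"
proof -
  have "0 \<le> b" using z(1) b[OF w] W_V[OF w] by force
  have "(\<Sum>u\<in>N w \<inter> W. z u) \<le> real (card (N w \<inter> W)) * b"
    using b W_V by (intro sum_z_le) auto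
  also have "\<dots> \<le> (real k - 2) * b"
    using N_of_W(4)[OF w] \<open>0 \<le> b\<close> by (intro mult_right_mono) auto
  finally have "(\<Sum>u\<in>N w \<inter> W. z u) \<le> (real k - 2) * b" .
  moreover have "(\<Sum>u\<in>N w \<inter> R. z u) \<le> 2 * 1"
    using w z R_V by (intro sum_N_W_R_le) auto
  ultimately show ?thesis using row_W[OF w] by linarith
qed

lemma bound_via_W:
  assumes b: "\<And>w. w \<in> W \<Longrightarrow> z w \<le> b"
  shows "(real (card V) - 5) * real k \<le> real d + 2 * (real k - 1) * (1 + b)"
proof -
  have cW: "real (card W) = real k - 1" using card_W(1) by linarith
  have "(\<Sum>w\<in>W. \<Sum>u\<in>N w \<inter> R. z u) \<le> (\<Sum>w\<in>W. 2 * 1)"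
    using z R_V by (intro sum_mono sum_N_W_R_le) auto
  moreover have "(\<Sum>w\<in>W. z w) \<le> (real k - 1) * b"
    using sum_z_le[of W b] b W_V cW by auto
  ultimately show ?thesis using main_bound cW by (simp add: algebra_simps)
qed

text \<open>One application of \<open>z_W_improve\<close> to the trivial bound 1 gives
  \<open>k / d\<close> on \<open>W\<close>. Inserted into \<open>bound_via_W\<close> this is
  contradictory, except for \<open>k = 3\<close>, \<open>d = 6\<close>, where a second round is
  needed.\<close>

lemma k_less_3: "k < 3"
proof (rule ccontr)
  assume "\<not> k < 3"
  then have k3: "3 \<le> real k" by simp
  have kd: "real k \<le> real d" using k_le_d by simp
  have nd: "real (card V) = real d + real k" using card_W(2) by linarith
  have zW: "z w \<le> real k / real d" if "w \<in> W" for w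
    using z_W_improve[OF that, of 1] z W_V k3 kd by (simp add: field_simps)
  define x where "x = real k / real d"
  have dx: "real d * x = real k" "0 \<le> x" using k3 kd by (auto simp: x_def)
  have bd: "(real (card V) - 5) * real k \<le> real d + 2 * (real k - 1) * (1 + x)"
    using bound_via_W zW unfolding x_def by blast
  consider "k = 3" "d = 6" | "k = 3" "d = 7" | "k = 4" "d = 5"
    | "8 * real k - 4 < (real k - 1) * real (card V)"
  proof -
    \<comment> \<open>The listed pairs are what remains for \<open>card V\<close> equal to 9 or 10
      and \<open>k\<close> equal to 3 or 4; everywhere else the inequality of the fourth case holds.
      For \<open>k \<ge> 5\<close>, \<open>k \<le> d\<close> even forces
      \<open>card V \<ge> 10\<close>.\<close>
    have "card V \<ge> 11 \<or> (k \<ge> 4 \<and> card V \<ge> 10) \<or> (k \<ge> 5 \<and> card V \<ge> 9)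
      \<or> (k = 3 \<and> d = 6) \<or> (k = 3 \<and> d = 7) \<or> (k = 4 \<and> d = 5)"
      using order(1) \<open>\<not> k < 3\<close> card_W(2) by linarith
    moreover have "8 * real k - 4 < (real k - 1) * real (card V)" if "card V \<ge> 11"
    proof -
      have "(real k - 1) * 11 \<le> (real k - 1) * real (card V)" using that k3 by (intro mult_left_mono) auto
      moreover have "8 * real k - 4 < (real k - 1) * 11" using k3 by simp
      ultimately show ?thesis by linarith
    qed
    moreover have "8 * real k - 4 < (real k - 1) * real (card V)" if "k \<ge> 4" "card V \<ge> 10"
    proof -
      have "(real k - 1) * 10 \<le> (real k - 1) * real (card V)" using that k3 by (intro mult_left_mono) auto
      moreover have "8 * real k - 4 < (real k - 1) * 10" using that by simp
      ultimately show ?thesis by linarith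
    qed
    moreover have "8 * real k - 4 < (real k - 1) * real (card V)" if "k \<ge> 5"
    proof -
      have "(real k - 1) * 10 \<le> (real k - 1) * real (card V)"
        using that kd nd by (intro mult_left_mono) auto
      moreover have "8 * real k - 4 < (real k - 1) * 10" using that by simp
      ultimately show ?thesis by linarith
    qed
    ultimately show thesis using that by blast
  qed
  then show False
  proof cases
    case 1
    \<comment> \<open>The bound 1/2 would only give 12 \<le> 12; another round lowers it to (2 +
      1/2) / 6 = 5/12.\<close>
    have "z w \<le> 5 / 12" if "w \<in> W" for w
      using z_W_improve[OF that, of "1/2"] zW 1 by (force simp: field_simps)
    then show False using bound_via_W[of "5/12"] nd 1 by simp
  next
    case 2
    then show False using bd nd dx by simp
  next
    case 3
    then show False using bd nd dx by simp
  next
    case 4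
    let ?n = "real (card V)"
    \<comment> \<open>Multiplying by \<open>d\<close> clears the fraction \<open>x\<close>. The
      resulting inequality contradicts n \<le> 2d, which is \<open>k \<le> d\<close>.\<close>
    have "real d * ((?n - 5) * real k) \<le> real d * (real d + 2 * (real k - 1) * (1 + x))"
      using bd kd k3 by (intro mult_left_mono) auto
    also have "\<dots> = real d * real d + 2 * (real k - 1) * (real d + real d * x)"
      by (simp add: algebra_simps)
    also have "\<dots> = real d * real d + 2 * (real k - 1) * ?n" by (simp add: dx nd)
    finally have "real d * ((?n - 5) * real k - real d) \<le> 2 * (real k - 1) * ?n"
      by (simp add: algebra_simps)
    moreover have "(?n - 5) * real k - real d = (real k - 1) * ?n - 4 * real k"
      by (simp add: nd algebra_simps)
    ultimately have *: "real d * ((real k - 1) * ?n - 4 * real k) \<le> 2 * (real k - 1) * ?n" by simp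
    have "4 * (real k - 1) < (real k - 1) * ?n - 4 * real k"
      using 4 by (simp add: algebra_simps)
    then have "real d * (4 * (real k - 1)) < real d * ((real k - 1) * ?n - 4 * real k)"
      using k3 kd by (intro mult_strict_left_mono) auto
    with * have "real d * (4 * (real k - 1)) < 2 * (real k - 1) * ?n" by linarith
    moreover have "2 * (real k - 1) * ?n \<le> 2 * (real k - 1) * (2 * real d)"
      using k3 kd nd by (intro mult_left_mono) auto
    ultimately show False by (simp add: algebra_simps)
  qed
qed

text \<open>The single vertex \<open>w\<close> of \<open>W\<close> has at most two neighbours in
  \<open>R\<close>, forming \<open>P\<close>. Separate bounds \<alpha> for \<open>R - P\<close> and
  \<beta> for \<open>P\<close> are improved in turn until \<open>main_bound\<close> fails.\<close>

lemma k_neq_2: "k \<noteq> 2"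
proof
  assume k2: "k = 2"
  then obtain w where Ww: "W = {w}" using card_W(1) by (auto simp: card_1_singleton_iff)
  have wW: "w \<in> W" and wV: "w \<in> V" using Ww W_V by auto
  define P where "P = N w \<inter> R"
  have d7: "7 \<le> real d" using card_W(2) k2 order(1) by linarith
  have Lz: "9 \<le> L" using order by linarith
  have NwW: "N w \<inter> W = {}" using Ww N_irrefl by auto
  have zw: "7 * z w \<le> (\<Sum>u\<in>P. z u)"
  proof -
    have "7 * z w \<le> real d * z w" using d7 z wV by (intro mult_right_mono) auto
    then show ?thesis using row_W[OF wW] NwW by (simp add: P_def)
  qed
  have Pw: "N u \<inter> W = (if u \<in> P then {w} else {})" if "u \<in> R" for u
    using that Ww N_sym[of u w] R_V[OF that] wV by (auto simp: P_def)
  \<comment> \<open>Two neighbours of \<open>u\<close> in \<open>P\<close> would have the three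
    common neighbours \<open>c\<close>, \<open>u\<close> and \<open>w\<close>.\<close>
  have adjP: "card (N u \<inter> P) \<le> 1" if u: "u \<in> R" for u
  proof (rule ccontr)
    assume "\<not> ?thesis"
    then have "2 \<le> card (N u \<inter> P)" by simp
    then obtain A where "A \<subseteq> N u \<inter> P" "card A = 2" by (meson obtain_subset_with_card_n)
    then obtain a b where ab: "a \<noteq> b" "a \<in> N u \<inter> P" "b \<in> N u \<inter> P" by (auto simp: card_2_iff)
    have V: "a \<in> V" "b \<in> V" "u \<in> V" using ab u R_V by (auto simp: P_def)
    have "{c, u, w} \<subseteq> N a \<inter> N b"
      using ab V c wV N_sym by (auto simp: P_def R_def)
    then have "card {c, u, w} \<le> card (N a \<inter> N b)" by (intro card_mono) auto
    moreover have "u \<noteq> c" "w \<noteq> c" "u \<noteq> w" using u wW V_split by auto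
    then have "card {c, u, w} = 3" by simp
    ultimately show False using codegree'[OF ab(1)] by simp
  qed
  \<comment> \<open>Of the at most two neighbours in \<open>R\<close>, at most one is in
    \<open>P\<close>; as \<alpha> \<le> \<beta>, the worst case is one of each kind.\<close>
  have nbr: "(\<Sum>v\<in>N u \<inter> R. z v) \<le> \<alpha> + \<beta>"
    if u: "u \<in> R" and ab: "\<And>v. v \<in> R - P \<Longrightarrow> z v \<le> \<alpha>" "\<And>v. v \<in> P \<Longrightarrow> z v \<le> \<beta>" "0 \<le> \<alpha>" "\<alpha> \<le> \<beta>"
    for u \<alpha> \<beta>
  proof -
    have PR: "P \<subseteq> R" by (simp add: P_def)
    have split: "N u \<inter> R = (N u \<inter> P) \<union> (N u \<inter> (R - P))" using PR by auto
    have disj: "(N u \<inter> P) \<inter> (N u \<inter> (R - P)) = {}" by auto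
    have finP: "finite (N u \<inter> P)" "finite (N u \<inter> (R - P))" by auto
    have cards: "card (N u \<inter> P) + card (N u \<inter> (R - P)) \<le> 2"
      using N_of_R(4)[OF u] card_Un_disjoint[OF finP disj] split by simp
    have "(\<Sum>v\<in>N u \<inter> R. z v) = (\<Sum>v\<in>N u \<inter> P. z v) + (\<Sum>v\<in>N u \<inter> (R - P). z v)"
      unfolding split by (rule sum.union_disjoint[OF finP disj])
    also have "\<dots> \<le> real (card (N u \<inter> P)) * \<beta> + real (card (N u \<inter> (R - P))) * \<alpha>"
      using ab PR R_V by (intro add_mono sum_z_le) auto
    also have "\<dots> \<le> real (card (N u \<inter> P)) * \<beta> + (2 - real (card (N u \<inter> P))) * \<alpha>"
      using cards ab by (intro add_left_mono mult_right_mono) auto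
    also have "\<dots> = real (card (N u \<inter> P)) * (\<beta> - \<alpha>) + 2 * \<alpha>" by (simp add: algebra_simps)
    also have "\<dots> \<le> 1 * (\<beta> - \<alpha>) + 2 * \<alpha>"
      using adjP[OF u] ab by (intro add_right_mono mult_right_mono) auto
    finally show ?thesis by simp
  qed
  have sumP: "(\<Sum>u\<in>P. z u) \<le> 2 * \<beta>" if "\<And>v. v \<in> P \<Longrightarrow> z v \<le> \<beta>" "0 \<le> \<beta>" for \<beta>
    using sum_N_W_R_le[OF wW, of \<beta>] that by (simp add: P_def)
  \<comment> \<open>Degrees are at most 3 on \<open>R - P\<close> and at most 4 on \<open>P\<close>,
    so \<open>L \<ge> 9\<close> leaves the divisors 6 and 5. On \<open>P\<close> the neighbour
    \<open>w\<close> adds at most 2/7 of \<beta>, whence 9/7.\<close>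
  have step: "(\<forall>u\<in>R - P. z u \<le> (1 + \<alpha> + \<beta>) / 6) \<and> (\<forall>u\<in>P. z u \<le> (1 + \<alpha> + 9/7 * \<beta>) / 5)"
    if ab: "\<forall>v\<in>R - P. z v \<le> \<alpha>" "\<forall>v\<in>P. z v \<le> \<beta>" "0 \<le> \<alpha>" "\<alpha> \<le> \<beta>" for \<alpha> \<beta>
  proof (intro conjI ballI)
    fix u assume u: "u \<in> R - P"
    then have uR: "u \<in> R" and W0: "N u \<inter> W = {}" using Pw by auto
    have "6 * z u \<le> (L - real (card (N u))) * z u"
      using Lz N_of_R(2,4)[OF uR] W0 z R_V[OF uR] by (intro mult_right_mono) auto
    then show "z u \<le> (1 + \<alpha> + \<beta>) / 6"
      using row'[OF R_V[OF uR]] N_of_R(3)[OF uR] W0 nbr[OF uR, of \<alpha> \<beta>] ab by simp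
  next
    fix u assume u: "u \<in> P"
    then have uR: "u \<in> R" by (simp add: P_def)
    then have W1: "N u \<inter> W = {w}" using Pw u by auto
    have "5 * z u \<le> (L - real (card (N u))) * z u"
      using Lz N_of_R(2,4)[OF uR] W1 z R_V[OF uR] by (intro mult_right_mono) auto
    moreover have "7 * z w \<le> 2 * \<beta>" using zw sumP[of \<beta>] ab by force
    ultimately show "z u \<le> (1 + \<alpha> + 9/7 * \<beta>) / 5"
      using row'[OF R_V[OF uR]] N_of_R(3)[OF uR] W1 nbr[OF uR, of \<alpha> \<beta>] ab by simp
  qed
  \<comment> \<open>Four rounds starting from the bound 1, with the values rounded up. As
    \<open>d = card V - 2\<close>, \<open>main_bound\<close> demands 1 \<le> card V - 8 \<le> 9/7
    times the sum over \<open>P\<close>, so a bound on \<open>P\<close> below 7/18 suffices, and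
    37/100 is one.\<close>
  have "(\<forall>v\<in>R - P. z v \<le> 1) \<and> (\<forall>v\<in>P. z v \<le> 1)"
    using z R_V by (auto simp: P_def)
  then have "(\<forall>v\<in>R - P. z v \<le> 1/2) \<and> (\<forall>v\<in>P. z v \<le> 2/3)"
    using step[of 1 1] by force
  then have "(\<forall>v\<in>R - P. z v \<le> 37/100) \<and> (\<forall>v\<in>P. z v \<le> 48/100)"
    using step[of "1/2" "2/3"] by force
  then have "(\<forall>v\<in>R - P. z v \<le> 31/100) \<and> (\<forall>v\<in>P. z v \<le> 40/100)"
    using step[of "37/100" "48/100"] by force
  then have "\<forall>v\<in>P. z v \<le> 37/100"
    using step[of "31/100" "40/100"] by force
  then have "(\<Sum>u\<in>P. z u) \<le> 2 * (37/100)" by (intro sumP) auto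
  moreover have "(real (card V) - 5) * 2 \<le> real d + (\<Sum>u\<in>P. z u) + 2 * z w"
    using main_bound k2 Ww by (simp add: P_def)
  moreover have "real d + 2 = real (card V)" using card_W(2) k2 by linarith
  moreover have "9 \<le> real (card V)" using order(1) by simp
  ultimately show False using zw by simp
qed

lemma card_N_c_ge: "card V \<le> card (N c) + 1"
  using k_less_3 k_neq_2 card_W(2) by (simp add: d_def R_def)

end

text \<open>For an eigenvalue \<mu> \<ge> \<open>card V\<close>, the scaled absolute values of an
  eigenvector would satisfy the locale above, and \<open>c\<close> would have degree at least
  \<open>card V - 1\<close>, against \<open>deg\<close>.\<close>

lemma Q_eigenvalue_less_order:
  assumes simple: "simple_graph V E"
    and codegree: "\<And>a b. a \<noteq> b \<Longrightarrow> card {u \<in> V. {u, a} \<in> E \<and> {u, b} \<in> E} \<le> 2"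
    and order: "9 \<le> card V"
    and deg: "\<And>v. v \<in> V \<Longrightarrow> card {u \<in> V. {u, v} \<in> E} + 2 \<le> card V"
    and eigenvalue: "Q_eigenvalue V E \<mu>"
  shows "\<mu> < real (card V)"
proof (rule ccontr)
  assume "\<not> ?thesis"
  then have \<mu>: "real (card V) \<le> \<mu>" by simp
  let ?N = "\<lambda>v. {u \<in> V. {u, v} \<in> E}"
  have "finite V" using simple by (simp add: simple_graph_def)
  obtain x where x0: "\<exists>v\<in>V. x v \<noteq> 0" and
    x: "\<And>v. v \<in> V \<Longrightarrow> real (card (?N v)) * x v + (\<Sum>u\<in>?N v. x u) = \<mu> * x v"
    using eigenvalue unfolding Q_eigenvalue_def Defs.degree_def by auto
  have "\<exists>c\<in>V. \<forall>v\<in>V. \<bar>x v\<bar> \<le> \<bar>x c\<bar>"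
  proof -
    have "Max ((\<lambda>v. \<bar>x v\<bar>) ` V) \<in> (\<lambda>v. \<bar>x v\<bar>) ` V"
      using \<open>finite V\<close> x0 by (intro Max_in) auto
    then obtain c where "c \<in> V" "Max ((\<lambda>v. \<bar>x v\<bar>) ` V) = \<bar>x c\<bar>" by auto
    moreover have "\<bar>x v\<bar> \<le> Max ((\<lambda>v. \<bar>x v\<bar>) ` V)" if "v \<in> V" for v
      using that \<open>finite V\<close> by (intro Max_ge) auto
    ultimately show ?thesis by auto
  qed
  then obtain c where c: "c \<in> V" "\<And>v. v \<in> V \<Longrightarrow> \<bar>x v\<bar> \<le> \<bar>x c\<bar>" by blast
  have pos: "\<bar>x c\<bar> > 0" using x0 c(2) by force
  interpret normalized_subeigenvector V E "\<lambda>v. \<bar>x v\<bar> / \<bar>x c\<bar>" \<mu> c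
  proof
    fix v assume v: "v \<in> V"
    have eq: "(\<mu> - real (card (?N v))) * x v = (\<Sum>u\<in>?N v. x u)"
      using x[OF v] by (simp add: algebra_simps)
    \<comment> \<open>A nonnegative coefficient can be pulled out of the absolute value.\<close>
    have "0 \<le> \<mu> - real (card (?N v))" using deg[OF v] \<mu> by linarith
    then have "(\<mu> - real (card (?N v))) * \<bar>x v\<bar> = \<bar>(\<mu> - real (card (?N v))) * x v\<bar>"
      by (simp only: abs_mult abs_of_nonneg)
    also have "\<dots> = \<bar>\<Sum>u\<in>?N v. x u\<bar>" by (simp only: eq)
    also have "\<dots> \<le> (\<Sum>u\<in>?N v. \<bar>x u\<bar>)" by (rule sum_abs)
    finally show "(\<mu> - real (card (?N v))) * (\<bar>x v\<bar> / \<bar>x c\<bar>) \<le> (\<Sum>u\<in>?N v. \<bar>x u\<bar> / \<bar>x c\<bar>)"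
      unfolding sum_divide_distrib[symmetric] using pos by (simp add: divide_right_mono)
  qed (use simple codegree order \<mu> c pos in \<open>auto simp: field_simps\<close>)
  show False using card_N_c_ge deg[OF c(1)] by (simp add: N_def)
qed

section \<open>Maximality\<close>

theorem theorem3p2:
  fixes n :: nat and VF :: "nat set" and EF :: "nat set set"
    and V :: "'a set" and E :: "'a set set"
  assumes "n \<ge> 9"
    and "(\<exists>t l. 1 \<le> t \<and> 2 \<le> l \<and> 5 \<le> t * l \<and> t * l \<le> n - 1 \<and> (VF, EF) = path_forest t l)
         \<or> (\<exists>l \<ge> 4. (VF, EF) = cycle_graph l)"
    and "admissible n VF EF V E"
    and "\<forall>(V' :: 'a set) E'. admissible n VF EF V' E' \<longrightarrow> Q_index V' E' \<le> Q_index V E"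
  shows "\<exists>v\<in>V. \<forall>u\<in>V. u \<noteq> v \<longrightarrow> {u, v} \<in> E"
proof (rule ccontr)
  assume no_dominating: "\<not> ?thesis"
  have G: "simple_graph V E" "card V = n" "outerplanar V E"
    using assms(3) by (auto simp: admissible_def)
  have fin: "finite V" using G(1) by (simp add: simple_graph_def)
  \<comment> \<open>Any vertex may be the centre of the competing star, which is built on the same
    vertex set \<open>V\<close>.\<close>
  obtain c where c: "c \<in> V" using G(2) assms(1) by (cases "V = {}") auto
  have deg: "card {u \<in> V. {u, v} \<in> E} + 2 \<le> card V" if v: "v \<in> V" for v
  proof -
    obtain w where w: "w \<in> V" "w \<noteq> v" "{w, v} \<notin> E"
      using no_dominating v by blast
    have "{v, v} \<notin> E" using G(1) by (auto simp: simple_graph_def)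
    with w have "{u \<in> V. {u, v} \<in> E} \<subseteq> V - {v, w}" by auto
    then have "card {u \<in> V. {u, v} \<in> E} \<le> card (V - {v, w})"
      using fin by (intro card_mono) auto
    moreover have "card (V - {v, w}) = card V - 2"
      using v w fin by (simp add: card_Diff_subset)
    ultimately show ?thesis using G(2) assms(1) by linarith
  qed
  have "V \<noteq> {}" using c by auto
  then have "Q_index V E < real n"
    using Q_eigenvalue_less_order[OF G(1) outerplanar_codegree_le_2[OF G(1,3)] _ deg
        Q_index_eigenvalue[OF fin]] G(2) assms(1) by simp
  moreover have "\<not> contains_subgraph VF EF V (star_edges V c)"
    using assms(2) path_forest_not_in_star cycle_graph_not_in_star by metis
  then have "admissible n VF EF V (star_edges V c)"
    using G(2) fin c
    by (simp add: admissible_def simple_graph_star connected_graph_star outerplanar_star)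
  then have "Q_index V (star_edges V c) \<le> Q_index V E" using assms(4) by blast
  moreover have "real n \<le> Q_index V (star_edges V c)"
    using Q_eigenvalue_le_Q_index[OF fin Q_eigenvalue_star[OF fin c]] G(2) assms(1) by simp
  ultimately show False by linarith
qed

end
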